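(* Let $d\ge3$ and $p\in(2,\infty]$ be given, and let $q=p/(p-1)$. For $i=1,\ldots,d-3$, let $P_i$ be a centrally symmetric polytope in $\mathbb{R}^{n_{i+1}}$ with the properties listed in the context. Let $\mathcal{A}=(a_{i_1i_2\cdots i_d})\in\mathbb{R}^{n_1\times n_2\times\cdots\times n_d}$ be an arbitrary non-zero order-$d$ tensor. Define $\Lambda_i^{\mathcal{A},d}:\mathbb{R}^{n_1}\times\cdots\times\mathbb{R}^{n_i}\to\mathbb{R}_+$ for $i=1,\ldots,d-2$ inductively by $$\Lambda_{d-2}^{\mathcal{A},d}(x^1,\ldots,x^{d-2})=\mathsf{vec}_p\big(\mathcal{A}(x^1,\ldots,x^{d-2})\big),$$ $$\Lambda_i^{\mathcal{A},d}(x^1,\ldots,x^i)=\mathrm{diam}_{P_i}\Big[\big\{y\in\mathbb{R}^{n_{i+1}}:\Lambda_{i+1}^{\mathcal{A},d}(x^1,\ldots,x^i,y)\le1\big\}^\circ\Big]\quad\text{for } i=d-3,d-4,\ldots,1.$$ Then the following hold: (a) For $j=1,\ldots,d-2$, any $k\in\{1,\ldots,j\}$ and any $\bar x^1,\ldots,\bar x^{k-1},\bar x^{k+1},\ldots,\bar x^j$ with $\bar x^i\in\mathbb{R}^{n_i}$, the function $x\mapsto\Lambda_j^{\mathcal{A},d}(\bar x^1,\ldots,\bar x^{k-1},x,\bar x^{k+1},\ldots,\bar x^j)$ is a semi-norm on $\mathbb{R}^{n_k}$. (b) Let $A$ be the $(n_2\times\cdots\times n_d)\times n_1$ matrix given by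 $A_{(i_2,\ldots,i_d),i_1}=a_{i_1i_2\cdots i_d}$. If $A$ has full column rank, then $\Lambda_1^{\mathcal{A},d}$ defines a norm on $\mathbb{R}^{n_1}$. (c) We have $\Lambda_{i-1}^{\mathcal{A}(x^1),d-1}(x^2,x^3,\ldots,x^i)=\Lambda_i^{\mathcal{A},d}(x^1,x^2,\ldots,x^i)$ for $i=2,3,\ldots,d-2$.
   Context: For $x^1,\ldots,x^i$ with $x^k\in\mathbb{R}^{n_k}$, $\mathcal{A}(x^1,\ldots,x^i)$ is the order-$(d-i)$ tensor with elements $\sum_{i_1,\ldots,i_i}a_{i_1\cdots i_d}x^1_{i_1}\cdots x^i_{i_i}$. For an $m\times n$ matrix $B$, $\mathsf{vec}_p(B)=\max\sum_{i,j}B_{ij}u_i^Tv_j$ over vectors $u_1,\ldots,u_m,v_1,\ldots,v_n$ in a real Hilbert space (dimension $m+n$ suffices) with $\|(\|u_1\|_2,\ldots,\|u_m\|_2)\|_p\le1$ and $\|(\|v_1\|_2,\ldots,\|v_n\|_2)\|_p\le1$. $K^\circ=\{y:x^Ty\le1\ \forall x\in K\}$. For a centrally symmetric polytope $P$ that is a neighbourhood of the origin, $\|x\|_P=\min\{\lambda\ge0:x\in\lambda P\}$ and $\mathrm{diam}_P(K)$ is the diameter of $K$ in the norm $\|\cdot\|_P$; $\mathrm{diam}_q(K)$ is the diameter in $\|\cdot\|_q$. Properties of $P_i$ (with $n=n_{i+1}$): it is constructible in deterministic polynomial time; $B_q^n(1)\subset P_i\subset B_q^n\big(O(n^{1/2}/(\log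 n)^{1/p})\big)$, where $B_q^n(\rho)=\{x\in\mathbb{R}^n:\|x\|_q\le\rho\}$; for every centrally symmetric convex body $K\subset\mathbb{R}^n$ with $B_2^n(r)\subset K\subset B_2^n(R)$ for some rationals $0<r\le R<\infty$, $\Omega((\log n)^{1/p}/n^{1/2})\,\mathrm{diam}_q(K)\le\mathrm{diam}_{P_i}(K)\le\mathrm{diam}_q(K)$; and if $K$ is given by a weak membership oracle, then $\mathrm{diam}_{P_i}(K)$ can be computed to any rational accuracy in deterministic oracle-polynomial time. In (c), the functions $\Lambda_{\bullet}^{\mathcal{A}(x^1),d-1}$ for the order-$(d-1)$ tensor $\mathcal{A}(x^1)\in\mathbb{R}^{n_2\times\cdots\times n_d}$ are defined by the same recursion, using in the space $\mathbb{R}^{n_{i+1}}$ the same polytope $P_i$ as for $\mathcal{A}$. *)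

theory Defs
  imports "HOL-Analysis.Analysis" "HOL-Analysis.Finite_Function_Topology"
begin

text \<open>
  Since the dimensions vary inside the recursion, \<open>\<real>\<^sup>n\<close> is the subspace \<open>Rn n\<close> of the
  finitely supported functions. Coordinates are indexed from \<open>0\<close>. The library norm of this type is
  the \<open>\<ell>\<^sub>1\<close> norm, so that on each \<open>Rn n\<close> its topology is the usual one.
\<close>

type_synonym rvec = "nat \<Rightarrow>\<^sub>0 real"

abbreviation coord :: "rvec \<Rightarrow> nat \<Rightarrow> real" where
  "coord \<equiv> Poly_Mapping.lookup"

definition Rn :: "nat \<Rightarrow> rvec set" where
  "Rn n = {x. Poly_Mapping.keys x \<subseteq> {..<n}}"

definition dot :: "nat \<Rightarrow> rvec \<Rightarrow> rvec \<Rightarrow> real" where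
  "dot n x y = (\<Sum>k<n. coord x k * coord y k)"

definition lp_norm :: "ereal \<Rightarrow> nat \<Rightarrow> (nat \<Rightarrow> real) \<Rightarrow> real" where
  "lp_norm p n f =
     (if p = \<infinity> then Max (insert 0 ((\<lambda>i. \<bar>f i\<bar>) ` {..<n}))
      else (\<Sum>i<n. \<bar>f i\<bar> powr real_of_ereal p) powr (1 / real_of_ereal p))"

definition lp_ball :: "ereal \<Rightarrow> nat \<Rightarrow> real \<Rightarrow> rvec set" where
  "lp_ball p n \<rho> = {x \<in> Rn n. lp_norm p n (coord x) \<le> \<rho>}"

text \<open>The case \<open>p = \<infinity>\<close> is separate because \<open>\<infinity> / \<infinity> = 0\<close> in \<^typ>\<open>ereal\<close>.\<close>

definition conjugate_exponent :: "ereal \<Rightarrow> ereal" where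
  "conjugate_exponent p = (if p = \<infinity> then 1 else p / (p - 1))"

definition seminorm_on :: "rvec set \<Rightarrow> (rvec \<Rightarrow> real) \<Rightarrow> bool" where
  "seminorm_on V f \<longleftrightarrow>
     (\<forall>x\<in>V. 0 \<le> f x) \<and>
     (\<forall>x\<in>V. \<forall>y\<in>V. f (x + y) \<le> f x + f y) \<and>
     (\<forall>x\<in>V. \<forall>t. f (t *\<^sub>R x) = \<bar>t\<bar> * f x)"

definition norm_on :: "rvec set \<Rightarrow> (rvec \<Rightarrow> real) \<Rightarrow> bool" where
  "norm_on V f \<longleftrightarrow> seminorm_on V f \<and> (\<forall>x\<in>V. f x = 0 \<longrightarrow> x = 0)"

definition polar :: "nat \<Rightarrow> rvec set \<Rightarrow> rvec set" where
  "polar n K = {y \<in> Rn n. \<forall>x\<in>K. dot n x y \<le> 1}"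

definition centrally_symmetric :: "rvec set \<Rightarrow> bool" where
  "centrally_symmetric K \<longleftrightarrow> (\<forall>x\<in>K. - x \<in> K)"

text \<open>
  Below, \<open>Inf\<close> and \<open>Sup\<close> over real sets stand for minima and maxima. In every use the set is
  nonempty and bounded and the extremum is attained, so no default values occur.
\<close>

definition gauge_norm :: "rvec set \<Rightarrow> rvec \<Rightarrow> real" where
  "gauge_norm P x = Inf {t. 0 \<le> t \<and> x \<in> (\<lambda>z. t *\<^sub>R z) ` P}"

definition diam_wrt :: "(rvec \<Rightarrow> real) \<Rightarrow> rvec set \<Rightarrow> real" where
  "diam_wrt N K = (SUP (x, y)\<in>K \<times> K. N (x - y))"

text \<open>
  The geometric properties of the polytopes, without the computability requirements, which no
  definition or claim here uses; \<open>c\<close> and \<open>C\<close> are the constants hidden in \<open>\<Omega>\<close> and \<open>O\<close>.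
  The asymptotic bounds are required from \<open>n = 2\<close> on, since \<open>log 1 = 0\<close>. For \<open>p = \<infinity>\<close> the
  exponent \<open>1 / p\<close> is \<open>0\<close>.
\<close>

definition approximating_polytope ::
    "real \<Rightarrow> real \<Rightarrow> ereal \<Rightarrow> nat \<Rightarrow> rvec set \<Rightarrow> bool" where
  "approximating_polytope c C p n P \<longleftrightarrow>
     (let q = conjugate_exponent p;
          lg = ln (real n) powr real_of_ereal (1 / p);
          diam_P = diam_wrt (gauge_norm P);
          diam_q = diam_wrt (\<lambda>x. lp_norm q n (coord x))
      in polytope P \<and> P \<subseteq> Rn n \<and> centrally_symmetric P \<and>
         lp_ball q n 1 \<subseteq> P \<and>
         (2 \<le> n \<longrightarrow> P \<subseteq> lp_ball q n (C * (sqrt (real n) / lg))) \<and>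
         (\<forall>K r R. K \<subseteq> Rn n \<and> convex K \<and> compact K \<and> centrally_symmetric K \<and>
             r \<in> \<rat> \<and> R \<in> \<rat> \<and> 0 < r \<and> r \<le> R \<and> lp_ball 2 n r \<subseteq> K \<and> K \<subseteq> lp_ball 2 n R \<longrightarrow>
             (2 \<le> n \<longrightarrow> c * (lg / sqrt (real n)) * diam_q K \<le> diam_P K) \<and>
             diam_P K \<le> diam_q K))"

text \<open>
  A tensor in \<open>\<real>\<^bsup>n\<^sub>1 \<times> \<dots> \<times> n\<^sub>d\<^esup>\<close> with \<open>ns = [n\<^sub>1, \<dots>, n\<^sub>d]\<close> is given by its entries at the
  multi-indices in \<open>multi_indices ns\<close>; values elsewhere are irrelevant.
\<close>

type_synonym tensor = "nat list \<Rightarrow> real"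

definition multi_indices :: "nat list \<Rightarrow> nat list set" where
  "multi_indices ns = {is. list_all2 (<) is ns}"

definition contract :: "nat list \<Rightarrow> tensor \<Rightarrow> rvec list \<Rightarrow> tensor" where
  "contract ns A xs js =
     (\<Sum>is\<in>multi_indices (take (length xs) ns).
        A (is @ js) * (\<Prod>k<length xs. coord (xs ! k) (is ! k)))"

definition vec_p :: "ereal \<Rightarrow> nat \<Rightarrow> nat \<Rightarrow> (nat \<Rightarrow> nat \<Rightarrow> real) \<Rightarrow> real" where
  "vec_p p m n B =
     Sup {\<Sum>i<m. \<Sum>j<n. B i j * dot (m + n) (u i) (v j) | u v.
            (\<forall>i<m. u i \<in> Rn (m + n)) \<and> (\<forall>j<n. v j \<in> Rn (m + n)) \<and>
            lp_norm p m (\<lambda>i. lp_norm 2 (m + n) (coord (u i))) \<le> 1 \<and>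
            lp_norm p n (\<lambda>j. lp_norm 2 (m + n) (coord (v j))) \<le> 1}"

text \<open>
  \<open>Lam p ns P A i [x\<^sup>1, \<dots>, x\<^sup>i]\<close> is \<open>\<Lambda>\<^sub>i(x\<^sup>1, \<dots>, x\<^sup>i)\<close> for \<open>1 \<le> i \<le> d - 2\<close>, where \<open>d = length ns\<close>.
  Lists count from \<open>0\<close>, so \<open>ns ! i\<close> is \<open>n\<^bsub>i+1\<^esub>\<close>, the dimension of the space of \<open>P i\<close>.
\<close>

function Lam :: "ereal \<Rightarrow> nat list \<Rightarrow> (nat \<Rightarrow> rvec set) \<Rightarrow> tensor \<Rightarrow> nat \<Rightarrow> rvec list \<Rightarrow> real" where
  "Lam p ns P A i xs =
     (if length ns \<le> i + 2
      then vec_p p (ns ! (length ns - 2)) (ns ! (length ns - 1))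
             (\<lambda>k l. contract ns A xs [k, l])
      else diam_wrt (gauge_norm (P i))
             (polar (ns ! i) {y \<in> Rn (ns ! i). Lam p ns P A (Suc i) (xs @ [y]) \<le> 1}))"
  by pat_completeness auto
termination
  by (relation "Wellfounded.measure (\<lambda>(p, ns, P, A, i, xs). length ns - i)") auto

text \<open>
  The unfolding \<open>A\<^bsub>(i\<^sub>2,\<dots>,i\<^sub>d),i\<^sub>1\<^esub> = a\<^bsub>i\<^sub>1\<dots>i\<^sub>d\<^esub>\<close>: its columns as vectors indexed by
  multi-indices, and its rank as the dimension of their span.
\<close>

definition unfolding_column :: "nat list \<Rightarrow> tensor \<Rightarrow> nat \<Rightarrow> nat list \<Rightarrow>\<^sub>0 real" where
  "unfolding_column ns A i = (\<Sum>is\<in>multi_indices (tl ns). Poly_Mapping.single is (A (i # is)))"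

definition unfolding_full_column_rank :: "nat list \<Rightarrow> tensor \<Rightarrow> bool" where
  "unfolding_full_column_rank ns A \<longleftrightarrow>
     dim (span (unfolding_column ns A ` {..<ns ! 0})) = ns ! 0"

declare Lam.simps [simp del]

end

theory Submission
  imports Defs
begin

text \<open>
  If \<open>N\<close> is a semi-norm, the polar of \<open>{y. N y \<le> 1}\<close> consists of the functionals dominated by \<open>N\<close>.
  Since both the gauge of \<open>P\<close> and \<open>N\<close> are support functions (Hahn--Banach), the diameter of this
  polar in the norm of \<open>P\<close> equals \<open>2 sup {N w | w \<in> P\<^sup>\<circ>}\<close>. Hence
  \<open>\<Lambda>\<^sub>i(x\<^sup>1, \<dots>, x\<^sup>i) = 2 sup {\<Lambda>\<^bsub>i+1\<^esub>(x\<^sup>1, \<dots>, x\<^sup>i, w) | w \<in> P\<^sub>i\<^sup>\<circ>}\<close>, and a finite supremum of semi-norms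
  is a semi-norm. Since \<open>P\<^sub>i\<^sup>\<circ>\<close> is absorbing, \<open>\<Lambda>\<^sub>1(x) = 0\<close> forces all entries of \<open>\<A>(x)\<close> to vanish.
\<close>

section \<open>Sublinear functions and the Hahn--Banach theorem\<close>

text \<open>Homogeneity for nonnegative factors covers linear functionals, gauges of convex sets and
  semi-norms alike, and allows the one-sided minorants built below.\<close>

definition sublinear_on :: "'a::real_vector set \<Rightarrow> ('a \<Rightarrow> real) \<Rightarrow> bool" where
  "sublinear_on V f \<longleftrightarrow>
     (\<forall>x\<in>V. \<forall>y\<in>V. f (x + y) \<le> f x + f y) \<and> (\<forall>x\<in>V. \<forall>t\<ge>0. f (t *\<^sub>R x) = t * f x)"

lemma sublinear_on_add: "sublinear_on V f \<Longrightarrow> x \<in> V \<Longrightarrow> y \<in> V \<Longrightarrow> f (x + y) \<le> f x + f y"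
  and sublinear_on_scale: "sublinear_on V f \<Longrightarrow> x \<in> V \<Longrightarrow> 0 \<le> t \<Longrightarrow> f (t *\<^sub>R x) = t * f x"
  by (auto simp: sublinear_on_def)

lemma sublinear_on_zero: "sublinear_on V f \<Longrightarrow> 0 \<in> V \<Longrightarrow> f 0 = 0"
  using sublinear_on_scale[of V f 0 0] by simp

lemma sublinear_on_neg:
  assumes "sublinear_on V f" "subspace V" "x \<in> V"
  shows "- f (- x) \<le> f x"
  using sublinear_on_add[OF assms(1,3), of "- x"] sublinear_on_zero[OF assms(1)] assms
  by (simp add: subspace_0 subspace_neg)

text \<open>The minorant is the infimum over t \<ge> 0 of f(x + t e) - t f(e). Since -g(e) \<le>
  g(-e) by sublinearity, the last conclusion together with g \<le> f forces g(e) = f(e) and g(-e) =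
  -g(e), so \<open>g\<close> is linear on the line through \<open>e\<close>.\<close>

lemma sublinear_minorant:
  assumes f: "sublinear_on V f" and V: "subspace V" and e: "e \<in> V"
  obtains g where "sublinear_on V g" "\<And>x. x \<in> V \<Longrightarrow> g x \<le> f x" "g (- e) \<le> - f e"
proof -
  define h where "h x t = f (x + t *\<^sub>R e) - t * f e" for x t
  define g where "g x = (INF t\<in>{0..}. h x t)" for x
  \<comment> \<open>Subadditivity for t e = (x + t e) + (-x) yields the lower bound -f(-x), so the
    infimum in \<open>g\<close> is a genuine one.\<close>
  have bdd: "bdd_below (h x ` {0..})" if x: "x \<in> V" for x
  proof (rule bdd_belowI2)
    fix t :: real assume "t \<in> {0..}"
    then have "t * f e = f (t *\<^sub>R e)" using f e by (simp add: sublinear_on_scale)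
    also have "\<dots> = f ((x + t *\<^sub>R e) + - x)" by simp
    also have "\<dots> \<le> f (x + t *\<^sub>R e) + f (- x)"
      using x e V by (intro sublinear_on_add[OF f]) (auto simp: subspace_add subspace_scale subspace_neg)
    finally show "- f (- x) \<le> h x t" by (simp add: h_def)
  qed
  have upper: "g x \<le> h x t" if "x \<in> V" "0 \<le> t" for x t
    unfolding g_def using bdd[OF that(1)] that by (intro cINF_lower) auto
  have lower: "c \<le> g x" if "\<And>t. 0 \<le> t \<Longrightarrow> c \<le> h x t" for c x
    unfolding g_def using that by (intro cINF_greatest) auto
  have le: "g x \<le> f x" if "x \<in> V" for x using upper[OF that, of 0] by (simp add: h_def)
  have add: "g (x + y) \<le> g x + g y" if x: "x \<in> V" and y: "y \<in> V" for x y
  proof -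
    have "g (x + y) \<le> h x s + h y t" if "0 \<le> s" "0 \<le> t" for s t
    proof -
      have "g (x + y) \<le> h (x + y) (s + t)" using x y V that by (intro upper) (auto simp: subspace_add)
      also have "\<dots> \<le> h x s + h y t"
        using sublinear_on_add[OF f, of "x + s *\<^sub>R e" "y + t *\<^sub>R e"] x y e V
        by (simp add: h_def subspace_add subspace_scale algebra_simps)
      finally show ?thesis .
    qed
    \<comment> \<open>The two infima are taken one after the other, first over \<open>t\<close> and
      then over \<open>s\<close>.\<close>
    then have "g (x + y) - h x s \<le> g y" if "0 \<le> s" for s
      using that by (intro lower) (simp add: algebra_simps)
    then have "g (x + y) - g y \<le> g x" by (intro lower) (simp add: algebra_simps)
    then show ?thesis by simp
  qed
  have scale_le: "g (c *\<^sub>R x) \<le> c * g x" if x: "x \<in> V" and c: "0 < c" for c x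
  proof -
    have "g (c *\<^sub>R x) / c \<le> h x t" if "0 \<le> t" for t
    proof -
      have "g (c *\<^sub>R x) \<le> h (c *\<^sub>R x) (c * t)"
        using x V c that by (intro upper) (auto simp: subspace_scale)
      also have "\<dots> = c * h x t"
        using sublinear_on_scale[OF f, of "x + t *\<^sub>R e" c] x e V c
        by (simp add: h_def subspace_add subspace_scale algebra_simps)
      finally show ?thesis using c by (simp add: field_simps)
    qed
    then have "g (c *\<^sub>R x) / c \<le> g x" by (rule lower)
    then show ?thesis using c by (simp add: field_simps)
  qed
  have zero: "g 0 = 0"
  proof (rule antisym)
    show "g 0 \<le> 0" using le[of 0] sublinear_on_zero[OF f] V by (simp add: subspace_0)
    show "0 \<le> g 0" using sublinear_on_scale[OF f e] by (intro lower) (simp add: h_def)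
  qed
  have "g (c *\<^sub>R x) = c * g x" if x: "x \<in> V" and c: "0 \<le> c" for c x
  proof (cases "c = 0")
    case False
    \<comment> \<open>Scaling back by 1/c turns the one-sided bound \<open>scale_le\<close> into an
      equality.\<close>
    have "g ((1 / c) *\<^sub>R (c *\<^sub>R x)) \<le> 1 / c * g (c *\<^sub>R x)"
      using x c False V by (intro scale_le) (auto simp: subspace_scale)
    then show ?thesis using scale_le[OF x, of c] c False by (simp add: field_simps)
  qed (simp add: zero)
  then have "sublinear_on V g" using add by (simp add: sublinear_on_def)
  moreover have "g (- e) \<le> - f e"
    using upper[of "- e" 1] e V sublinear_on_zero[OF f] by (simp add: h_def subspace_neg subspace_0)
  ultimately show thesis using that le by blast
qed

text \<open>The one-vector minorant is applied to the vectors of the list in turn; finitely many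
  directions suffice in \<open>Rn n\<close>, so no maximality principle enters.\<close>

lemma sublinear_minorant_finite:
  assumes "sublinear_on V f" "subspace V" "set es \<subseteq> V"
  obtains g where "sublinear_on V g" "\<And>x. x \<in> V \<Longrightarrow> g x \<le> f x"
    "\<And>e. e \<in> set es \<Longrightarrow> g (- e) = - g e"
proof -
  have "\<exists>g. sublinear_on V g \<and> (\<forall>x\<in>V. g x \<le> f x) \<and> (\<forall>e\<in>set es. g (- e) = - g e)"
    using assms(3)
  proof (induction es)
    case Nil
    then show ?case using assms(1) by auto
  next
    case (Cons e es)
    then obtain g where g: "sublinear_on V g" "\<And>x. x \<in> V \<Longrightarrow> g x \<le> f x"
      and odd: "\<And>e. e \<in> set es \<Longrightarrow> g (- e) = - g e" by auto
    have e: "e \<in> V" using Cons.prems by simp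
    obtain h where h: "sublinear_on V h" "\<And>x. x \<in> V \<Longrightarrow> h x \<le> g x" "h (- e) \<le> - g e"
      using sublinear_minorant[OF g(1) assms(2) e] by blast
    \<comment> \<open>Oddness survives lowering: if \<open>g\<close> is odd at \<open>a\<close> and
      h \<le> g, then h(-a) \<le> g(-a) = -g(a) \<le> -h(a) \<le> h(-a), the last by sublinearity of
      \<open>h\<close>.\<close>
    have "h (- a) = - h a" if a: "a = e \<or> a \<in> set es" for a
    proof -
      have aV: "a \<in> V" "- a \<in> V" using a Cons.prems assms(2) by (auto simp: subspace_neg)
      have "h (- a) \<le> - g a"
        using a h(3) h(2)[OF aV(2)] odd[of a] by auto
      then show ?thesis
        using h(2)[OF aV(1)] sublinear_on_neg[OF h(1) assms(2) aV(1)] by linarith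
    qed
    then show ?case using h(1,2) g(2) by (intro exI[of _ h]) (auto intro: order_trans)
  qed
  then show thesis using that by blast
qed

section \<open>Coordinates, the pairing \<open>dot\<close> and linear functionals on
  \<open>Rn n\<close>\<close>

lemma coord_add: "coord (x + y) k = coord x k + coord y k"
  and coord_diff: "coord (x - y) k = coord x k - coord y k"
  and coord_neg: "coord (- x) k = - coord x k"
  and coord_zero: "coord 0 k = 0"
  by (simp_all add: lookup_add lookup_minus)

lemma lookup_scaleR: "Poly_Mapping.lookup (t *\<^sub>R x) k = t *\<^sub>R Poly_Mapping.lookup (x :: 'a \<Rightarrow>\<^sub>0 real) k"
proof -
  have "finite {i. t *\<^sub>R Poly_Mapping.lookup x i \<noteq> 0}"
    by (rule finite_subset[OF _ finite_lookup[of x]]) auto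
  then show ?thesis by (simp add: scaleR_poly_mapping_def)
qed

lemmas coord_simps = coord_add coord_diff coord_neg coord_zero lookup_scaleR

lemma Rn_iff: "x \<in> Rn n \<longleftrightarrow> (\<forall>k\<ge>n. coord x k = 0)"
  by (auto simp: Rn_def in_keys_iff subset_iff not_less[symmetric])

lemma subspace_Rn: "subspace (Rn n)"
  by (auto simp: subspace_def Rn_iff coord_simps)

lemmas Rn_closed [simp] = subspace_0[OF subspace_Rn] subspace_add[OF subspace_Rn]
  subspace_diff[OF subspace_Rn] subspace_neg[OF subspace_Rn] subspace_scale[OF subspace_Rn]

abbreviation unit :: "nat \<Rightarrow> rvec" where
  "unit k \<equiv> Poly_Mapping.single k 1"

lemma coord_unit: "coord (unit k) i = (if i = k then 1 else 0)"
  by (simp add: lookup_single when_def)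

lemma unit_in_Rn [simp]: "k < n \<Longrightarrow> unit k \<in> Rn n"
  by (simp add: Rn_iff coord_unit)

lemma dot_add: "dot n (x + y) z = dot n x z + dot n y z" "dot n z (x + y) = dot n z x + dot n z y"
  and dot_diff: "dot n (x - y) z = dot n x z - dot n y z" "dot n z (x - y) = dot n z x - dot n z y"
  and dot_neg: "dot n (- x) z = - dot n x z" "dot n z (- x) = - dot n z x"
  and dot_scale: "dot n (t *\<^sub>R x) z = t * dot n x z" "dot n z (t *\<^sub>R x) = t * dot n z x"
  and dot_zero: "dot n 0 z = 0" "dot n z 0 = 0"
  by (simp_all add: dot_def coord_simps algebra_simps sum.distrib sum_subtractf sum_negf sum_distrib_left)

lemmas dot_simps = dot_add dot_diff dot_neg dot_scale dot_zero

lemma dot_commute: "dot n x y = dot n y x"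
  by (simp add: dot_def mult.commute)

lemma dot_unit: "k < n \<Longrightarrow> dot n x (unit k) = coord x k"
  by (simp add: dot_def coord_unit if_distrib cong: if_cong)

lemma Rn_expand:
  assumes "x \<in> Rn n"
  shows "x = (\<Sum>k<n. coord x k *\<^sub>R unit k)"
proof (rule poly_mapping_eqI)
  fix i
  have "coord (\<Sum>k<n. coord x k *\<^sub>R unit k) i = (\<Sum>k<n. if k = i then coord x k else 0)"
    unfolding lookup_sum by (intro sum.cong) (auto simp: lookup_scaleR coord_unit)
  then show "coord x i = coord (\<Sum>k<n. coord x k *\<^sub>R unit k) i"
    using assms by (simp add: Rn_iff)
qed

lemma sublinear_on_sum:
  assumes "sublinear_on V f" "subspace V" "finite I" "\<And>i. i \<in> I \<Longrightarrow> x i \<in> V"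
  shows "f (\<Sum>i\<in>I. x i) \<le> (\<Sum>i\<in>I. f (x i))"
  using assms(3,4)
proof (induction I)
  case empty
  then show ?case using sublinear_on_zero[OF assms(1)] assms(2) by (simp add: subspace_0)
next
  case (insert i I)
  then have "f (x i + (\<Sum>i\<in>I. x i)) \<le> f (x i) + f (\<Sum>i\<in>I. x i)"
    using assms(2) by (intro sublinear_on_add[OF assms(1)]) (auto intro: subspace_sum)
  then show ?case using insert by simp
qed

text \<open>A sublinear function that is odd at every unit vector is linear. Hence, after lowering
  \<open>f\<close> along the unit vectors, the values there are the coordinates of the representing
  vector. Lowering along \<open>w\<close> beforehand secures equality at \<open>w\<close>.\<close>

lemma Hahn_Banach_Rn:
  assumes f: "sublinear_on (Rn n) f" and w: "w \<in> Rn n"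
  obtains z where "z \<in> Rn n" "\<And>y. y \<in> Rn n \<Longrightarrow> dot n z y \<le> f y" "dot n z w = f w"
proof -
  obtain f1 where f1: "sublinear_on (Rn n) f1" "\<And>x. x \<in> Rn n \<Longrightarrow> f1 x \<le> f x" "f1 (- w) \<le> - f w"
    using sublinear_minorant[OF f subspace_Rn w] by blast
  have "set (map unit [0..<n]) \<subseteq> Rn n" by auto
  from sublinear_minorant_finite[OF f1(1) subspace_Rn this]
  obtain g where g: "sublinear_on (Rn n) g" "\<And>x. x \<in> Rn n \<Longrightarrow> g x \<le> f1 x"
    and odd: "\<And>e. e \<in> set (map unit [0..<n]) \<Longrightarrow> g (- e) = - g e" by blast
  define z where "z = (\<Sum>k<n. g (unit k) *\<^sub>R unit k)"
  have z: "z \<in> Rn n" unfolding z_def by (intro subspace_sum[OF subspace_Rn]) simp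
  have coord_z: "coord z k = g (unit k)" if "k < n" for k
    using that by (simp add: z_def lookup_sum lookup_scaleR coord_unit if_distrib cong: if_cong)
  \<comment> \<open>Subadditivity over the coordinate expansion gives this direction; oddness at the
    unit vectors handles negative coordinates.\<close>
  have le: "g y \<le> dot n z y" if y: "y \<in> Rn n" for y
  proof -
    have "g y = g (\<Sum>k<n. coord y k *\<^sub>R unit k)" using Rn_expand[OF y] by simp
    also have "\<dots> \<le> (\<Sum>k<n. g (coord y k *\<^sub>R unit k))"
      by (intro sublinear_on_sum[OF g(1) subspace_Rn]) auto
    also have "\<dots> = (\<Sum>k<n. coord z k * coord y k)"
    proof (intro sum.cong refl)
      fix k assume k: "k \<in> {..<n}"
      show "g (coord y k *\<^sub>R unit k) = coord z k * coord y k"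
      proof (cases "0 \<le> coord y k")
        case True
        then show ?thesis using sublinear_on_scale[OF g(1), of "unit k" "coord y k"] k coord_z by simp
      next
        case False
        have "g (coord y k *\<^sub>R unit k) = g ((- coord y k) *\<^sub>R (- unit k))" by simp
        also have "\<dots> = (- coord y k) * g (- unit k)"
          using False k by (intro sublinear_on_scale[OF g(1)]) auto
        finally show ?thesis using k odd[of "unit k"] coord_z by simp
      qed
    qed
    finally show ?thesis by (simp add: dot_def)
  qed
  \<comment> \<open>The converse is \<open>le\<close> at -y combined with -g(-y) \<le> g(y).\<close>
  have ge: "dot n z y \<le> g y" if y: "y \<in> Rn n" for y
    using le[of "- y"] sublinear_on_neg[OF g(1) subspace_Rn y] y by (simp add: dot_simps)
  show thesis
  proof (rule that[OF z])
    show "dot n z y \<le> f y" if "y \<in> Rn n" for y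
      using ge g(2) f1(2) that by (meson order_trans)
    \<comment> \<open>At -w the chain is -dot(z, w) \<le> g(-w) \<le> f1(-w) \<le> -f(w).\<close>
    have "f w \<le> dot n z w" using le[of "- w"] g f1(3) w
      using ge[of "-w"] by (smt (verit) dot_simps Rn_closed)
    then show "dot n z w = f w" using ge g(2) f1(2) w by (smt (verit))
  qed
qed

section \<open>Semi-norms, gauges, polars and the diameter formula\<close>

lemma seminorm_onD:
  assumes "seminorm_on V f"
  shows "x \<in> V \<Longrightarrow> 0 \<le> f x" "x \<in> V \<Longrightarrow> y \<in> V \<Longrightarrow> f (x + y) \<le> f x + f y"
    "x \<in> V \<Longrightarrow> f (t *\<^sub>R x) = \<bar>t\<bar> * f x"
  using assms by (auto simp: seminorm_on_def)

lemma seminorm_on_neg: "seminorm_on V f \<Longrightarrow> x \<in> V \<Longrightarrow> f (- x) = f x"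
  using seminorm_onD(3)[of V f x "-1"] by simp

lemma seminorm_on_sublinear: "seminorm_on V f \<Longrightarrow> sublinear_on V f"
  by (auto simp: seminorm_on_def sublinear_on_def)

lemma seminorm_on_scale: "seminorm_on V f \<Longrightarrow> 0 \<le> c \<Longrightarrow> seminorm_on V (\<lambda>x. c * f x)"
  by (simp add: seminorm_on_def distrib_left[symmetric] mult_left_mono mult.left_commute)

text \<open>All three properties pass to pointwise suprema; boundedness guarantees that each
  \<open>Sup\<close> is a real supremum and not a default value.\<close>

lemma seminorm_on_SUP:
  assumes W: "W \<noteq> {}" and f: "\<And>w. w \<in> W \<Longrightarrow> seminorm_on V (f w)"
    and bdd: "\<And>x. x \<in> V \<Longrightarrow> bdd_above ((\<lambda>w. f w x) ` W)" and V: "subspace V"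
  shows "seminorm_on V (\<lambda>x. SUP w\<in>W. f w x)"
  unfolding seminorm_on_def
proof (intro conjI ballI allI)
  let ?F = "\<lambda>x. SUP w\<in>W. f w x"
  fix x assume x: "x \<in> V"
  obtain w0 where w0: "w0 \<in> W" using W by blast
  show "0 \<le> ?F x" using cSUP_upper[OF w0 bdd[OF x]] seminorm_onD(1)[OF f[OF w0] x] by simp
  show "?F (x + y) \<le> ?F x + ?F y" if y: "y \<in> V" for y
  proof (rule cSUP_least[OF W])
    fix w assume w: "w \<in> W"
    show "f w (x + y) \<le> ?F x + ?F y"
      using seminorm_onD(2)[OF f[OF w] x y] cSUP_upper[OF w bdd[OF x]] cSUP_upper[OF w bdd[OF y]] by simp
  qed
  have le: "?F (t *\<^sub>R x) \<le> \<bar>t\<bar> * ?F x" if x: "x \<in> V" for t x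
  proof (rule cSUP_least[OF W])
    fix w assume w: "w \<in> W"
    show "f w (t *\<^sub>R x) \<le> \<bar>t\<bar> * ?F x"
      using seminorm_onD(3)[OF f[OF w] x, of t] cSUP_upper[OF w bdd[OF x]] by (simp add: mult_left_mono)
  qed
  fix t :: real
  show "?F (t *\<^sub>R x) = \<bar>t\<bar> * ?F x"
  proof (cases "t = 0")
    case True
    then show ?thesis using W f x seminorm_onD(3)[OF f x, of _ 0] by simp
  next
    case False
    \<comment> \<open>Applying \<open>le\<close> with factor 1/t at the point t x gives the reverse
      inequality.\<close>
    have "?F ((1 / t) *\<^sub>R (t *\<^sub>R x)) \<le> \<bar>1 / t\<bar> * ?F (t *\<^sub>R x)"
      using x V by (intro le) (simp add: subspace_scale)
    then show ?thesis using le[OF x, of t] False by (simp add: field_simps)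
  qed
qed

text \<open>A radial form of being a neighbourhood of the origin. For \<open>P\<close> it makes the
  gauge finite and the polar bounded; for the polar of \<open>P\<close> it supplies a positive
  multiple of each unit vector.\<close>

definition absorbing :: "nat \<Rightarrow> rvec set \<Rightarrow> bool" where
  "absorbing n K \<longleftrightarrow> (\<forall>x\<in>Rn n. \<exists>t>0. t *\<^sub>R x \<in> K)"

lemma gauge_norm_le: "0 \<le> t \<Longrightarrow> x = t *\<^sub>R z \<Longrightarrow> z \<in> P \<Longrightarrow> gauge_norm P x \<le> t"
  unfolding gauge_norm_def by (intro cInf_lower bdd_belowI[of _ 0]) auto

text \<open>Absorption makes the set under the infimum nonempty, so a lower bound of its members is
  a lower bound of the gauge.\<close>

lemma gauge_norm_ge:
  assumes "absorbing n P" "x \<in> Rn n" "\<And>t z. 0 \<le> t \<Longrightarrow> x = t *\<^sub>R z \<Longrightarrow> z \<in> P \<Longrightarrow> b \<le> t"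
  shows "b \<le> gauge_norm P x"
  unfolding gauge_norm_def
proof (rule cInf_greatest)
  obtain t where t: "t > 0" "t *\<^sub>R x \<in> P" using assms(1,2) by (auto simp: absorbing_def)
  then have "x = (1 / t) *\<^sub>R (t *\<^sub>R x)" "0 \<le> 1 / t" by auto
  with t(2) show "{t. 0 \<le> t \<and> x \<in> (*\<^sub>R) t ` P} \<noteq> {}" by blast
qed (use assms(3) in auto)

lemma sublinear_on_gauge_norm:
  assumes P: "absorbing n P" "convex P"
  shows "sublinear_on (Rn n) (gauge_norm P)"
proof -
  have P0: "0 \<in> P" using P(1) unfolding absorbing_def by (metis Rn_closed(1) scaleR_zero_right)
  have add: "gauge_norm P (x + y) \<le> gauge_norm P x + gauge_norm P y"
    if x: "x \<in> Rn n" and y: "y \<in> Rn n" for x y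
  proof -
    have *: "gauge_norm P (x + y) \<le> s + t"
      if s: "0 \<le> s" "x = s *\<^sub>R z" "z \<in> P" and t: "0 \<le> t" "y = t *\<^sub>R z'" "z' \<in> P" for s t z z'
    proof (cases "s + t = 0")
      case True
      then have "s = 0" "t = 0" using s(1) t(1) by auto
      then show ?thesis using s t gauge_norm_le[of 0 "x + y" 0 P] P0 by simp
    next
      case False
      \<comment> \<open>Convexity enters here: x + y is s + t times a convex combination of two
        points of \<open>P\<close>.\<close>
      have "(s / (s + t)) *\<^sub>R z + (t / (s + t)) *\<^sub>R z' \<in> P"
        using s t False by (intro convexD[OF P(2)]) (auto simp: add_divide_distrib[symmetric])
      moreover have "x + y = (s + t) *\<^sub>R ((s / (s + t)) *\<^sub>R z + (t / (s + t)) *\<^sub>R z')"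
        using s t False by (simp add: scaleR_add_right)
      ultimately show ?thesis using s(1) t(1) by (intro gauge_norm_le) auto
    qed
    have "gauge_norm P (x + y) - s \<le> gauge_norm P y" if "0 \<le> s" "x = s *\<^sub>R z" "z \<in> P" for s z
      using *[OF that] by (intro gauge_norm_ge[OF P(1) y]) (simp add: algebra_simps)
    then have "gauge_norm P (x + y) - gauge_norm P y \<le> gauge_norm P x"
      by (intro gauge_norm_ge[OF P(1) x]) (simp add: algebra_simps)
    then show ?thesis by simp
  qed
  have le: "gauge_norm P (c *\<^sub>R x) \<le> c * gauge_norm P x" if x: "x \<in> Rn n" and c: "0 < c" for c x
  proof -
    have "gauge_norm P (c *\<^sub>R x) / c \<le> gauge_norm P x"
    proof (rule gauge_norm_ge[OF P(1) x])
      fix t z assume "0 \<le> t" "x = t *\<^sub>R z" "z \<in> P"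
      then have "gauge_norm P (c *\<^sub>R x) \<le> c * t" using c by (intro gauge_norm_le) auto
      then show "gauge_norm P (c *\<^sub>R x) / c \<le> t" using c by (simp add: field_simps)
    qed
    then show ?thesis using c by (simp add: field_simps)
  qed
  have zero: "gauge_norm P 0 = 0"
    using gauge_norm_le[of 0 0 0 P] P0 gauge_norm_ge[OF P(1), of 0 0] by simp
  have "gauge_norm P (c *\<^sub>R x) = c * gauge_norm P x" if x: "x \<in> Rn n" and c: "0 \<le> c" for c x
  proof (cases "c = 0")
    case False
    have "gauge_norm P ((1 / c) *\<^sub>R (c *\<^sub>R x)) \<le> 1 / c * gauge_norm P (c *\<^sub>R x)"
      using x c False by (intro le) auto
    then show ?thesis using le[OF x, of c] c False by (simp add: field_simps)
  qed (simp add: zero)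
  then show ?thesis using add by (simp add: sublinear_on_def)
qed

text \<open>An absorbing set contains positive multiples of each unit vector and of its negative.
  These bound every coordinate on the polar from both sides, and a semi-norm is bounded where the
  coordinates are.\<close>

lemma bdd_above_seminorm_polar:
  assumes P: "absorbing n P" and N: "seminorm_on (Rn n) N"
  shows "bdd_above (N ` polar n P)"
proof -
  have "\<exists>b. \<forall>w\<in>polar n P. \<bar>coord w k\<bar> \<le> b" if k: "k < n" for k
  proof -
    have "unit k \<in> Rn n" "- unit k \<in> Rn n" using k by auto
    with P obtain s t where st: "s > 0" "s *\<^sub>R unit k \<in> P" "t > 0" "t *\<^sub>R (- unit k) \<in> P"
      unfolding absorbing_def by metis
    have "\<bar>coord w k\<bar> \<le> max (1 / s) (1 / t)" if w: "w \<in> polar n P" for w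
    proof -
      have "dot n (s *\<^sub>R unit k) w \<le> 1" "dot n (t *\<^sub>R (- unit k)) w \<le> 1"
        using w st by (simp_all only: polar_def mem_Collect_eq)
      then have "s * coord w k \<le> 1" "- (t * coord w k) \<le> 1"
        using dot_unit[OF k, of w] by (simp_all add: dot_simps dot_commute)
      then have "coord w k \<le> 1 / s" "- coord w k \<le> 1 / t" using st by (simp_all add: field_simps)
      then show ?thesis by linarith
    qed
    then show ?thesis by blast
  qed
  then obtain b where b: "\<And>k w. k < n \<Longrightarrow> w \<in> polar n P \<Longrightarrow> \<bar>coord w k\<bar> \<le> b k" by metis
  show ?thesis
  proof (rule bdd_aboveI2)
    fix w assume w: "w \<in> polar n P"
    then have wR: "w \<in> Rn n" by (simp add: polar_def)
    have "N w = N (\<Sum>k<n. coord w k *\<^sub>R unit k)" using Rn_expand[OF wR] by simp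
    also have "\<dots> \<le> (\<Sum>k<n. N (coord w k *\<^sub>R unit k))"
      by (intro sublinear_on_sum[OF seminorm_on_sublinear[OF N] subspace_Rn]) auto
    also have "\<dots> = (\<Sum>k<n. \<bar>coord w k\<bar> * N (unit k))"
      by (intro sum.cong refl seminorm_onD(3)[OF N]) auto
    also have "\<dots> \<le> (\<Sum>k<n. b k * N (unit k))"
      using b[OF _ w] seminorm_onD(1)[OF N] by (intro sum_mono mult_right_mono) auto
    finally show "N w \<le> (\<Sum>k<n. b k * N (unit k))" .
  qed
qed

lemma polar_unit_ball_iff:
  assumes N: "seminorm_on (Rn n) N" and z: "z \<in> Rn n"
  shows "z \<in> polar n {y \<in> Rn n. N y \<le> 1} \<longleftrightarrow> (\<forall>y\<in>Rn n. dot n z y \<le> N y)"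
proof
  assume "z \<in> polar n {y \<in> Rn n. N y \<le> 1}"
  then have *: "dot n z y \<le> 1" if "y \<in> Rn n" "N y \<le> 1" for y
    using that by (simp add: polar_def dot_commute)
  show "\<forall>y\<in>Rn n. dot n z y \<le> N y"
  proof
    fix y assume y: "y \<in> Rn n"
    \<comment> \<open>Dividing by any s > 0 above N(y), instead of by N(y) itself, covers the
      vectors with N(y) = 0; afterwards s tends to N(y).\<close>
    have **: "dot n z y \<le> s" if s: "s > 0" "N y \<le> s" for s
      using *[of "(1 / s) *\<^sub>R y"] y s seminorm_onD(3)[OF N y, of "1 / s"]
      by (simp add: dot_simps field_simps)
    show "dot n z y \<le> N y"
    proof (rule field_le_epsilon)
      fix e :: real assume "0 < e"
      then show "dot n z y \<le> N y + e" using seminorm_onD(1)[OF N y] by (intro **) auto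
    qed
  qed
next
  assume "\<forall>y\<in>Rn n. dot n z y \<le> N y"
  then show "z \<in> polar n {y \<in> Rn n. N y \<le> 1}"
    using z by (force simp: polar_def dot_commute)
qed

text \<open>Each inequality uses Hahn-Banach once: for the gauge to bound the diameter from above,
  for \<open>N\<close> to bound it from below. The factor 2 is the passage from a symmetric set to
  its differences.\<close>

lemma diam_polar_unit_ball:
  assumes P: "absorbing n P" "convex P" "P \<subseteq> Rn n" and N: "seminorm_on (Rn n) N"
  shows "diam_wrt (gauge_norm P) (polar n {y \<in> Rn n. N y \<le> 1}) = (SUP w\<in>polar n P. 2 * N w)"
proof -
  let ?K = "polar n {y \<in> Rn n. N y \<le> 1}"
  let ?S = "SUP w\<in>polar n P. 2 * N w"
  have K: "z \<in> ?K \<longleftrightarrow> z \<in> Rn n \<and> (\<forall>y\<in>Rn n. dot n z y \<le> N y)" for z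
    using polar_unit_ball_iff[OF N, of z] by (auto simp: polar_def)
  have zero_polar: "0 \<in> polar n Q" for Q by (simp add: polar_def dot_simps)
  have bdd: "bdd_above ((\<lambda>w. 2 * N w) ` polar n P)"
  proof -
    obtain M where "\<And>w. w \<in> polar n P \<Longrightarrow> N w \<le> M"
      using bdd_above_seminorm_polar[OF P(1) N] by (auto simp: bdd_above_def)
    then show ?thesis by (intro bdd_aboveI2[of _ _ "2 * M"]) simp
  qed
  have le: "gauge_norm P (x - y) \<le> ?S" if x: "x \<in> ?K" and y: "y \<in> ?K" for x y
  proof -
    have xy: "x - y \<in> Rn n" using x y K by simp
    \<comment> \<open>The functional \<open>w\<close> is tight at x - y. Being dominated by the
      gauge, it is at most 1 on \<open>P\<close> and so lies in the polar of
      \<open>P\<close>.\<close>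
    obtain w where w: "w \<in> Rn n" "\<And>z. z \<in> Rn n \<Longrightarrow> dot n w z \<le> gauge_norm P z"
      "dot n w (x - y) = gauge_norm P (x - y)"
      using Hahn_Banach_Rn[OF sublinear_on_gauge_norm[OF P(1,2)] xy] by blast
    have "dot n z w \<le> 1" if z: "z \<in> P" for z
      using w(2)[of z] gauge_norm_le[of 1 z z P] z P(3) by (force simp: dot_commute)
    then have wP: "w \<in> polar n P" using w(1) by (simp add: polar_def)
    have "dot n x w \<le> N w" "dot n y (- w) \<le> N (- w)" using x y K w(1) by auto
    then have "gauge_norm P (x - y) \<le> 2 * N w"
      using w(3) seminorm_on_neg[OF N w(1)] by (simp add: dot_simps dot_commute)
    also have "\<dots> \<le> ?S" using wP bdd by (rule cSUP_upper)
    finally show ?thesis .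
  qed
  have bdd': "bdd_above ((\<lambda>(x, y). gauge_norm P (x - y)) ` (?K \<times> ?K))"
    using le by (intro bdd_aboveI2[of _ _ ?S]) auto
  show ?thesis
  proof (rule antisym)
    show "diam_wrt (gauge_norm P) ?K \<le> ?S"
      unfolding diam_wrt_def using le zero_polar by (intro cSUP_least) auto
    show "?S \<le> diam_wrt (gauge_norm P) ?K"
    proof (rule cSUP_least)
      show "polar n P \<noteq> {}" using zero_polar by blast
      fix w assume w: "w \<in> polar n P"
      then have wR: "w \<in> Rn n" by (simp add: polar_def)
      \<comment> \<open>The functional \<open>z\<close> is tight for \<open>N\<close> at
        \<open>w\<close>. Both \<open>z\<close> and its negative lie in \<open>?K\<close>, so their
        difference 2z competes for the diameter.\<close>
      obtain z where z: "z \<in> Rn n" "\<And>y. y \<in> Rn n \<Longrightarrow> dot n z y \<le> N y" "dot n z w = N w"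
        using Hahn_Banach_Rn[OF seminorm_on_sublinear[OF N] wR] by blast
      have "dot n (- z) y \<le> N y" if "y \<in> Rn n" for y
        using z(2)[of "- y"] seminorm_on_neg[OF N that] that by (simp add: dot_simps)
      then have zK: "(z, - z) \<in> ?K \<times> ?K" using z K by auto
      have "2 * N w \<le> gauge_norm P (z - - z)"
      proof (rule gauge_norm_ge[OF P(1)])
        show "z - - z \<in> Rn n" using z(1) by (intro Rn_closed)
        fix t u assume u: "0 \<le> t" "z - - z = t *\<^sub>R u" "u \<in> P"
        have "2 * N w = dot n (z - - z) w" using z(3) by (simp only: dot_simps)
        also have "\<dots> = t * dot n u w" by (simp only: u(2) dot_simps)
        also have "\<dots> \<le> t * 1" using u w by (intro mult_left_mono) (auto simp: polar_def)
        finally show "2 * N w \<le> t" by simp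
      qed
      also have "\<dots> \<le> diam_wrt (gauge_norm P) ?K"
        unfolding diam_wrt_def using cSUP_upper[OF zK bdd'] by simp
      finally show "2 * N w \<le> diam_wrt (gauge_norm P) ?K" .
    qed
  qed
qed

section \<open>Matrices, polytopes and tensor contraction\<close>

lemma lp_norm_scale:
  assumes "0 < q"
  shows "lp_norm (ereal q) n (\<lambda>i. t * f i) = \<bar>t\<bar> * lp_norm (ereal q) n f"
  using assms by (simp add: lp_norm_def abs_mult powr_mult sum_distrib_left[symmetric] sum_nonneg powr_powr)

lemma lp_norm_nonneg: "0 \<le> lp_norm p n f"
  by (simp add: lp_norm_def)

lemma real_of_ereal_gt_0: "0 < p \<Longrightarrow> p \<noteq> \<infinity> \<Longrightarrow> 0 < real_of_ereal p"
  by (cases p) auto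

text \<open>For finite exponent, one entry above 1 in modulus already pushes the sum of powers, and
  with it the root, above 1.\<close>

lemma abs_le_1_if_lp_norm_le_1:
  assumes p: "0 < p" and f: "lp_norm p n f \<le> 1" and i: "i < n"
  shows "\<bar>f i\<bar> \<le> 1"
proof (cases "p = \<infinity>")
  case True
  then show ?thesis using f i by (simp add: lp_norm_def)
next
  case False
  define r where "r = real_of_ereal p"
  have r: "0 < r" using real_of_ereal_gt_0[OF p False] by (simp add: r_def)
  show ?thesis
  proof (rule ccontr)
    assume "\<not> \<bar>f i\<bar> \<le> 1"
    then have "1 < \<bar>f i\<bar> powr r" using r by (intro gr_one_powr) auto
    also have "\<dots> \<le> (\<Sum>i<n. \<bar>f i\<bar> powr r)" using i by (intro member_le_sum) auto
    finally have "1 < (\<Sum>i<n. \<bar>f i\<bar> powr r) powr (1 / r)" using r by (intro gr_one_powr) auto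
    then show False using f False by (simp add: lp_norm_def r_def)
  qed
qed

lemma lp_norm_indicator_le_1:
  assumes p: "0 < p"
  shows "lp_norm p n (\<lambda>i. if i = k then 1 else 0) \<le> 1"
proof (cases "p = \<infinity>")
  case True
  then show ?thesis by (auto simp: lp_norm_def)
next
  case False
  define r where "r = real_of_ereal p"
  have r: "0 < r" using real_of_ereal_gt_0[OF p False] by (simp add: r_def)
  have "(\<Sum>i<n. \<bar>if i = k then 1 else 0\<bar> powr r) = (\<Sum>i<n. if i = k then 1 else 0 :: real)"
    using r by (intro sum.cong) auto
  also have "\<dots> \<le> 1" by simp
  finally have "(\<Sum>i<n. \<bar>if i = k then 1 else 0\<bar> powr r) powr (1 / r) \<le> 1 powr (1 / r)"
    using r by (intro powr_mono2) (auto intro: sum_nonneg)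
  then show ?thesis using False by (simp add: lp_norm_def r_def)
qed

lemma lp_norm_unit_le_1: "0 < p \<Longrightarrow> lp_norm p n (coord (unit k)) \<le> 1"
  using lp_norm_indicator_le_1[of p n k] by (simp add: coord_unit[abs_def])

lemma lp_norm_0: "lp_norm p n (\<lambda>_. 0) = 0"
proof -
  have "Max (insert 0 ((\<lambda>i. 0::real) ` {..<n})) = 0" by (intro Max_eqI) auto
  then show ?thesis by (simp add: lp_norm_def)
qed

lemma lp_norm_coord_0: "lp_norm p n (coord 0) = 0"
proof -
  have "coord 0 = (\<lambda>_. 0)" by auto
  then show ?thesis using lp_norm_0[of p n] by simp
qed

lemma lp_norm_neg: "lp_norm p n (coord (- x)) = lp_norm p n (coord x)"
  by (simp add: lp_norm_def)

lemma lp_norm_mono: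
  assumes p: "0 < p" and le: "\<And>i. i < n \<Longrightarrow> \<bar>f i\<bar> \<le> \<bar>g i\<bar>"
  shows "lp_norm p n f \<le> lp_norm p n g"
proof (cases "p = \<infinity>")
  case True
  have "Max (insert 0 ((\<lambda>i. \<bar>f i\<bar>) ` {..<n})) \<le> Max (insert 0 ((\<lambda>i. \<bar>g i\<bar>) ` {..<n}))"
  proof (rule Max.boundedI)
    fix a assume "a \<in> insert 0 ((\<lambda>i. \<bar>f i\<bar>) ` {..<n})"
    then consider "a = 0" | i where "i < n" "a = \<bar>f i\<bar>" by auto
    then show "a \<le> Max (insert 0 ((\<lambda>i. \<bar>g i\<bar>) ` {..<n}))"
    proof cases
      case (2 i)
      have "\<bar>g i\<bar> \<le> Max (insert 0 ((\<lambda>i. \<bar>g i\<bar>) ` {..<n}))" using 2 by (intro Max_ge) auto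
      then show ?thesis using 2 le[of i] by linarith
    qed simp
  qed auto
  then show ?thesis using True by (simp add: lp_norm_def)
next
  case False
  then show ?thesis using real_of_ereal_gt_0[OF p False] le
    by (auto simp: lp_norm_def intro!: powr_mono2 sum_mono sum_nonneg)
qed

text \<open>The conjugate exponent is finite even for p = \<infinity>, where it is 1; this makes
  \<open>lp_norm_scale\<close>, stated for real exponents, applicable.\<close>

lemma conjugate_exponent_real:
  assumes "2 < p"
  obtains q where "conjugate_exponent p = ereal q" "0 < q"
proof (cases p)
  case (real r)
  then have "2 < r" using assms by simp
  then have "conjugate_exponent p = ereal (r / (r - 1))" "0 < r / (r - 1)"
    by (simp_all add: conjugate_exponent_def real one_ereal_def)
  then show thesis using that by blast
qed (use assms that[of 1] in \<open>auto simp: conjugate_exponent_def one_ereal_def\<close>)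

lemma absorbing_if_unit_ball_subset:
  assumes q: "0 < q" and sub: "lp_ball (ereal q) n 1 \<subseteq> P"
  shows "absorbing n P"
  unfolding absorbing_def
proof
  fix x assume x: "x \<in> Rn n"
  let ?N = "lp_norm (ereal q) n (coord x)"
  \<comment> \<open>The summand 1 keeps the denominator positive when \<open>x\<close> is
    zero.\<close>
  define t where "t = 1 / (1 + ?N)"
  have t: "t > 0" using lp_norm_nonneg[of "ereal q" n "coord x"] by (simp add: t_def)
  have "coord (t *\<^sub>R x) = (\<lambda>i. t * coord x i)" by (auto simp: lookup_scaleR)
  then have "lp_norm (ereal q) n (coord (t *\<^sub>R x)) = t * ?N"
    using lp_norm_scale[OF q] t by simp
  also have "\<dots> \<le> 1" using lp_norm_nonneg[of "ereal q" n "coord x"] by (simp add: t_def field_simps)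
  finally have "t *\<^sub>R x \<in> lp_ball (ereal q) n 1" using x by (simp add: lp_ball_def)
  then show "\<exists>t>0. t *\<^sub>R x \<in> P" using t sub by blast
qed

text \<open>A linear functional on a convex hull is bounded by its bound on the finitely many
  generators, so a small multiple of any vector lies in the polar.\<close>

lemma absorbing_polar_polytope:
  assumes "polytope P"
  shows "absorbing n (polar n P)"
  unfolding absorbing_def
proof
  fix w assume w: "w \<in> Rn n"
  obtain v where v: "finite v" "P = convex hull v" using assms by (auto simp: polytope_def)
  \<comment> \<open>The sum over the generators bounds each of its terms and makes sense even for an
    empty \<open>v\<close>.\<close>
  define M where "M = (\<Sum>z\<in>v. \<bar>dot n z w\<bar>)"
  have M: "0 \<le> M" by (simp add: M_def sum_nonneg)
  have "convex {z. dot n z w \<le> M}"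
  proof (rule convexI)
    fix x y :: rvec and s t :: real
    assume *: "x \<in> {z. dot n z w \<le> M}" "y \<in> {z. dot n z w \<le> M}" "0 \<le> s" "0 \<le> t" "s + t = 1"
    then have "s * dot n x w + t * dot n y w \<le> s * M + t * M"
      by (intro add_mono mult_left_mono) auto
    also have "\<dots> = M" using * by (simp add: distrib_right[symmetric])
    finally show "s *\<^sub>R x + t *\<^sub>R y \<in> {z. dot n z w \<le> M}" by (simp add: dot_simps)
  qed
  moreover have "v \<subseteq> {z. dot n z w \<le> M}"
  proof
    fix z assume "z \<in> v"
    then have "\<bar>dot n z w\<bar> \<le> M" unfolding M_def using v by (intro member_le_sum) auto
    then show "z \<in> {z. dot n z w \<le> M}" by simp
  qed
  ultimately have "P \<subseteq> {z. dot n z w \<le> M}" unfolding v by (rule hull_minimal[rotated])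
  then have "dot n z w \<le> M" if "z \<in> P" for z using that by auto
  then have "(1 / (M + 1)) *\<^sub>R w \<in> polar n P"
    using w M by (force simp: polar_def dot_simps field_simps)
  then show "\<exists>t>0. t *\<^sub>R w \<in> polar n P" using M by (intro exI[of _ "1 / (M + 1)"]) auto
qed

section \<open>The value \<open>vec_p\<close> as a supremum of semi-norms\<close>

definition pairing :: "nat \<Rightarrow> nat \<Rightarrow> (nat \<Rightarrow> nat \<Rightarrow> real) \<Rightarrow> (nat \<Rightarrow> rvec) \<times> (nat \<Rightarrow> rvec) \<Rightarrow> real" where
  "pairing m n B = (\<lambda>(u, v). \<Sum>i<m. \<Sum>j<n. B i j * dot (m + n) (u i) (v j))"

text \<open>This index set does not depend on the matrix, while \<open>pairing\<close> is linear in
  it; that is the shape required by \<open>seminorm_on_SUP\<close>.\<close>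

definition vec_feasible :: "ereal \<Rightarrow> nat \<Rightarrow> nat \<Rightarrow> ((nat \<Rightarrow> rvec) \<times> (nat \<Rightarrow> rvec)) set" where
  "vec_feasible p m n = {(u, v).
     (\<forall>i<m. u i \<in> Rn (m + n)) \<and> (\<forall>j<n. v j \<in> Rn (m + n)) \<and>
     lp_norm p m (\<lambda>i. lp_norm 2 (m + n) (coord (u i))) \<le> 1 \<and>
     lp_norm p n (\<lambda>j. lp_norm 2 (m + n) (coord (v j))) \<le> 1}"

text \<open>Feasibility bounds every vector length by 1, hence every coordinate. The crude factor m
  + n stands in for Cauchy-Schwarz, since only boundedness matters.\<close>

lemma vec_feasible_abs_dot_le:
  assumes p: "0 < p" and uv: "(u, v) \<in> vec_feasible p m n" and "i < m" "j < n"
  shows "\<bar>dot (m + n) (u i) (v j)\<bar> \<le> real (m + n)"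
proof -
  have "\<bar>lp_norm 2 (m + n) (coord (u i))\<bar> \<le> 1" "\<bar>lp_norm 2 (m + n) (coord (v j))\<bar> \<le> 1"
    using uv assms(3,4) by (auto simp: vec_feasible_def intro: abs_le_1_if_lp_norm_le_1[OF p])
  then have c: "\<bar>coord (u i) k\<bar> \<le> 1" "\<bar>coord (v j) k\<bar> \<le> 1" if "k < m + n" for k
    using abs_le_1_if_lp_norm_le_1[of 2 "m + n" _ k] that by auto
  have "\<bar>dot (m + n) (u i) (v j)\<bar> \<le> (\<Sum>k<m+n. \<bar>coord (u i) k\<bar> * \<bar>coord (v j) k\<bar>)"
    unfolding dot_def abs_mult[symmetric] by (rule sum_abs)
  also have "\<dots> \<le> (\<Sum>k<m+n. 1 * 1)" using c by (intro sum_mono mult_mono) auto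
  finally show ?thesis by simp
qed

lemma bdd_above_abs_pairing:
  assumes p: "0 < p"
  shows "bdd_above ((\<lambda>w. \<bar>pairing m n B w\<bar>) ` vec_feasible p m n)"
proof (rule bdd_aboveI2)
  fix w assume "w \<in> vec_feasible p m n"
  then obtain u v where w: "w = (u, v)" "(u, v) \<in> vec_feasible p m n" by (cases w) auto
  have "\<bar>pairing m n B w\<bar> \<le> (\<Sum>i<m. \<Sum>j<n. \<bar>B i j * dot (m + n) (u i) (v j)\<bar>)"
    unfolding pairing_def w case_prod_conv by (rule order_trans[OF sum_abs sum_mono[OF sum_abs]])
  also have "\<dots> \<le> (\<Sum>i<m. \<Sum>j<n. \<bar>B i j\<bar> * real (m + n))"
    unfolding abs_mult using vec_feasible_abs_dot_le[OF p w(2)] by (intro sum_mono mult_left_mono) auto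
  finally show "\<bar>pairing m n B w\<bar> \<le> (\<Sum>i<m. \<Sum>j<n. \<bar>B i j\<bar> * real (m + n))" .
qed

lemma vec_feasible_nonempty: "vec_feasible p m n \<noteq> {}"
proof -
  have "(\<lambda>_. 0, \<lambda>_. 0) \<in> vec_feasible p m n"
    by (simp add: vec_feasible_def lp_norm_0 lp_norm_coord_0)
  then show ?thesis by blast
qed

text \<open>Negating every \<open>u i\<close> keeps feasibility and flips the sign of the objective,
  so absolute values do not raise the supremum. They make each member of the family a semi-norm in
  the matrix.\<close>

lemma vec_p_eq_SUP_abs:
  assumes p: "0 < p"
  shows "vec_p p m n B = (SUP w\<in>vec_feasible p m n. \<bar>pairing m n B w\<bar>)"
proof -
  let ?F = "vec_feasible p m n"
  have bdd: "bdd_above ((\<lambda>w. pairing m n B w) ` ?F)"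
    using bdd_above_abs_pairing[OF p, of m n B] unfolding bdd_above_def by (force intro: order_trans[OF abs_ge_self])
  have "vec_p p m n B = (SUP w\<in>?F. pairing m n B w)"
    unfolding vec_p_def by (rule arg_cong[of _ _ Sup]) (auto simp: pairing_def vec_feasible_def image_def)
  also have "\<dots> = (SUP w\<in>?F. \<bar>pairing m n B w\<bar>)"
  proof (rule antisym)
    show "(SUP w\<in>?F. pairing m n B w) \<le> (SUP w\<in>?F. \<bar>pairing m n B w\<bar>)"
      using bdd_above_abs_pairing[OF p, of m n B]
      by (intro cSUP_mono[OF vec_feasible_nonempty]) (auto intro: abs_ge_self)
    show "(SUP w\<in>?F. \<bar>pairing m n B w\<bar>) \<le> (SUP w\<in>?F. pairing m n B w)"
    proof (rule cSUP_least[OF vec_feasible_nonempty])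
      fix w assume "w \<in> ?F"
      then obtain u v where w: "w = (u, v)" "(u, v) \<in> ?F" by (cases w) auto
      then have w': "(\<lambda>i. - u i, v) \<in> ?F" by (simp add: vec_feasible_def lp_norm_neg del: lookup_uminus)
      have "pairing m n B (\<lambda>i. - u i, v) = - pairing m n B w"
        by (simp add: pairing_def w dot_simps sum_negf)
      then show "\<bar>pairing m n B w\<bar> \<le> (SUP w\<in>?F. pairing m n B w)"
        using cSUP_upper[OF w(2) bdd] cSUP_upper[OF w' bdd] w(1) by (auto simp: abs_if)
    qed
  qed
  finally show ?thesis .
qed

lemma seminorm_on_vec_p:
  assumes p: "0 < p" and V: "subspace V"
    and add: "\<And>x y i j. B (x + y) i j = B x i j + B y i j"
    and scale: "\<And>t x i j. B (t *\<^sub>R x) i j = t * B x i j"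
  shows "seminorm_on V (\<lambda>x. vec_p p m n (B x))"
  unfolding vec_p_eq_SUP_abs[OF p]
proof (rule seminorm_on_SUP[OF vec_feasible_nonempty _ bdd_above_abs_pairing[OF p] V])
  fix w :: "(nat \<Rightarrow> rvec) \<times> (nat \<Rightarrow> rvec)"
  have "pairing m n (B (x + y)) w = pairing m n (B x) w + pairing m n (B y) w" for x y
    by (simp add: pairing_def add distrib_right sum.distrib split: prod.split)
  moreover have "pairing m n (B (t *\<^sub>R x)) w = t * pairing m n (B x) w" for t x
    by (simp add: pairing_def scale sum_distrib_left mult.assoc split: prod.split)
  ultimately show "seminorm_on V (\<lambda>x. \<bar>pairing m n (B x) w\<bar>)"
    by (simp add: seminorm_on_def abs_mult abs_triangle_ineq)
qed

text \<open>The feasible pair whose only nonzero vectors are \<open>u k\<close> and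
  \<open>v l\<close>, both the same unit vector, isolates the entry \<open>B k l\<close>.\<close>

lemma vec_p_eq_0_imp:
  assumes p: "0 < p" and zero: "vec_p p m n B = 0" and k: "k < m" and l: "l < n"
  shows "B k l = 0"
proof -
  \<comment> \<open>The vector \<open>unit 0\<close> belongs to \<open>Rn (m + n)\<close> because k
    < m makes m + n positive.\<close>
  define u :: "nat \<Rightarrow> rvec" where "u i = (if i = k then unit 0 else 0)" for i
  define v :: "nat \<Rightarrow> rvec" where "v j = (if j = l then unit 0 else 0)" for j
  have *: "lp_norm p N (\<lambda>i. lp_norm 2 (m + n) (coord (if i = h then unit 0 else 0))) \<le> 1" for N h
  proof -
    have "lp_norm p N (\<lambda>i. lp_norm 2 (m + n) (coord (if i = h then unit 0 else 0)))
        \<le> lp_norm p N (\<lambda>i. if i = h then 1 else 0)"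
      using lp_norm_unit_le_1[of 2 "m + n" 0]
      by (intro lp_norm_mono[OF p]) (auto simp: lp_norm_coord_0 lp_norm_nonneg)
    then show ?thesis using lp_norm_indicator_le_1[OF p, of N h] by linarith
  qed
  have "(u, v) \<in> vec_feasible p m n"
    using * k l by (simp add: vec_feasible_def u_def v_def del: single_one)
  then have "\<bar>pairing m n B (u, v)\<bar> \<le> 0"
    using cSUP_upper[OF _ bdd_above_abs_pairing[OF p]] zero vec_p_eq_SUP_abs[OF p, of m n B] by metis
  moreover have "B i j * dot (m + n) (u i) (v j) = (if j = l then if i = k then B i j else 0 else 0)" for i j
    using k by (simp add: u_def v_def dot_unit dot_simps coord_unit del: single_one)
  then have "pairing m n B (u, v) = B k l"
    using k l by (simp add: pairing_def)
  ultimately show ?thesis by simp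
qed

section \<open>Multi-indices and tensor contraction\<close>

lemma multi_indices_Nil: "multi_indices [] = {[]}"
  by (simp add: multi_indices_def)

lemma multi_indices_Cons: "multi_indices (n # ns) = (\<lambda>(i, is). i # is) ` ({..<n} \<times> multi_indices ns)"
  by (auto simp: multi_indices_def list_all2_Cons2 image_iff)

lemma multi_indices_snoc:
  "multi_indices (ns @ [n]) = (\<lambda>(is, i). is @ [i]) ` (multi_indices ns \<times> {..<n})"
proof
  show "multi_indices (ns @ [n]) \<subseteq> (\<lambda>(is, i). is @ [i]) ` (multi_indices ns \<times> {..<n})"
    by (auto simp: multi_indices_def list_all2_append2 list_all2_Cons2 image_iff)
qed (auto simp: multi_indices_def intro!: list_all2_appendI)

lemma finite_multi_indices [simp]: "finite (multi_indices ns)"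
  by (induction ns) (auto simp: multi_indices_Nil multi_indices_Cons)

lemma length_multi_indices: "is \<in> multi_indices ns \<Longrightarrow> length is = length ns"
  by (auto simp: multi_indices_def list_all2_lengthD)

lemma sum_multi_indices_Cons:
  "(\<Sum>is\<in>multi_indices (n # ns). f is) = (\<Sum>i<n. \<Sum>is\<in>multi_indices ns. f (i # is))"
  unfolding multi_indices_Cons
  by (subst sum.reindex) (auto simp: inj_on_def sum.cartesian_product case_prod_unfold)

lemma sum_multi_indices_snoc:
  "(\<Sum>is\<in>multi_indices (ns @ [n]). f is) = (\<Sum>is\<in>multi_indices ns. \<Sum>i<n. f (is @ [i]))"
  unfolding multi_indices_snoc
  by (subst sum.reindex) (auto simp: inj_on_def sum.cartesian_product case_prod_unfold)

text \<open>With the factor of slot \<open>k\<close> split off, the rest is free of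
  \<open>x\<close>, which exhibits linearity in that slot.\<close>

lemma contract_update:
  assumes k: "k < length xs"
  shows "contract ns A (xs[k := x]) js =
    (\<Sum>is\<in>multi_indices (take (length xs) ns).
       coord x (is ! k) * (A (is @ js) * (\<Prod>i\<in>{..<length xs} - {k}. coord (xs ! i) (is ! i))))"
proof -
  have "(\<Prod>i<length xs. coord (xs[k := x] ! i) (is ! i)) =
      coord x (is ! k) * (\<Prod>i\<in>{..<length xs} - {k}. coord (xs ! i) (is ! i))" for "is"
    using k by (subst prod.remove[of _ k]) (auto intro!: prod.cong)
  then show ?thesis by (simp add: contract_def mult.left_commute)
qed

lemma contract_update_add:
  "k < length xs \<Longrightarrow> contract ns A (xs[k := x + y]) js =
     contract ns A (xs[k := x]) js + contract ns A (xs[k := y]) js"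
  by (simp add: contract_update lookup_add distrib_right sum.distrib)

lemma contract_update_scale:
  "k < length xs \<Longrightarrow> contract ns A (xs[k := t *\<^sub>R x]) js = t * contract ns A (xs[k := x]) js"
  by (simp add: contract_update lookup_scaleR sum_distrib_left mult.assoc)

lemma contract_single:
  "contract (n # ns) A [x] js = (\<Sum>i<n. A (i # js) * coord x i)"
  by (simp add: contract_def sum_multi_indices_Cons multi_indices_Nil)

text \<open>Interchanging the sum over the first index with the sum over the others; claim (c) rests
  on this identity.\<close>

lemma contract_contract:
  "contract ns (contract (n # ns) A [x]) xs js = contract (n # ns) A (x # xs) js"
proof -
  have "contract ns (contract (n # ns) A [x]) xs js =
      (\<Sum>is\<in>multi_indices (take (length xs) ns). \<Sum>i<n.
         A (i # is @ js) * coord x i * (\<Prod>k<length xs. coord (xs ! k) (is ! k)))"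
    by (simp add: contract_def[of ns] contract_single sum_distrib_right)
  also have "\<dots> = (\<Sum>i<n. \<Sum>is\<in>multi_indices (take (length xs) ns).
         A (i # is @ js) * coord x i * (\<Prod>k<length xs. coord (xs ! k) (is ! k)))"
    by (rule sum.swap)
  also have "\<dots> = contract (n # ns) A (x # xs) js"
    by (simp add: contract_def[of "n # ns"] sum_multi_indices_Cons prod.lessThan_Suc_shift mult.assoc del: prod.lessThan_Suc)
  finally show ?thesis .
qed

text \<open>A unit vector in the next mode freezes its index, so entries of a contraction can be
  reached one mode at a time.\<close>

lemma contract_snoc_unit:
  assumes len: "length xs < length ns" and i: "i < ns ! length xs"
  shows "contract ns A (xs @ [unit i]) js = contract ns A xs (i # js)"
proof -
  have "contract ns A (xs @ [unit i]) js =
      (\<Sum>is\<in>multi_indices (take (length xs) ns). \<Sum>j<ns ! length xs.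
         A ((is @ [j]) @ js) * (\<Prod>k<Suc (length xs). coord ((xs @ [unit i]) ! k) ((is @ [j]) ! k)))"
    using len by (simp add: contract_def take_Suc_conv_app_nth sum_multi_indices_snoc del: prod.lessThan_Suc)
  also have "\<dots> = (\<Sum>is\<in>multi_indices (take (length xs) ns). \<Sum>j<ns ! length xs.
         if j = i then A (is @ i # js) * (\<Prod>k<length xs. coord (xs ! k) (is ! k)) else 0)"
  proof (intro sum.cong refl)
    fix "is" j assume "is \<in> multi_indices (take (length xs) ns)"
    then have l: "length is = length xs" using length_multi_indices[of "is"] len by simp
    then have "(\<Prod>k<length xs. coord ((xs @ [unit i]) ! k) ((is @ [j]) ! k)) =
        (\<Prod>k<length xs. coord (xs ! k) (is ! k))"
      by (intro prod.cong) (auto simp: nth_append)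
    then show "A ((is @ [j]) @ js) * (\<Prod>k<Suc (length xs). coord ((xs @ [unit i]) ! k) ((is @ [j]) ! k)) =
        (if j = i then A (is @ i # js) * (\<Prod>k<length xs. coord (xs ! k) (is ! k)) else 0)"
      using l by (simp add: nth_append coord_unit)
  qed
  also have "\<dots> = contract ns A xs (i # js)" using i by (simp add: contract_def)
  finally show ?thesis .
qed

section \<open>The unfolding and its column rank\<close>

lemma lookup_unfolding_column:
  "Poly_Mapping.lookup (unfolding_column ns A i) is = (if is \<in> multi_indices (tl ns) then A (i # is) else 0)"
proof -
  have "Poly_Mapping.lookup (unfolding_column ns A i) is =
      (\<Sum>js\<in>multi_indices (tl ns). if js = is then A (i # js) else 0)"
    unfolding unfolding_column_def lookup_sum by (intro sum.cong) (auto simp: lookup_single)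
  then show ?thesis by simp
qed

text \<open>Full column rank makes the columns distinct and independent, and the hypothesis says
  that their combination with coefficients from \<open>x\<close> vanishes.\<close>

lemma unfolding_injective:
  assumes rank: "unfolding_full_column_rank ns A" and x: "x \<in> Rn (ns ! 0)"
    and zero: "\<And>is. is \<in> multi_indices (tl ns) \<Longrightarrow> (\<Sum>i<ns ! 0. A (i # is) * coord x i) = 0"
  shows "x = 0"
proof -
  let ?c = "unfolding_column ns A" and ?n = "ns ! 0"
  \<comment> \<open>A basis of n elements chosen among at most n columns exhausts them; hence no two
    columns coincide.\<close>
  obtain B where B: "B \<subseteq> ?c ` {..<?n}" "independent B" "card B = dim (?c ` {..<?n})"
    by (rule basis_exists)
  have cB: "card B = ?n" using rank B(3) by (simp add: unfolding_full_column_rank_def)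
  have "card (?c ` {..<?n}) \<le> ?n" using card_image_le[of "{..<?n}" ?c] by simp
  then have Beq: "B = ?c ` {..<?n}" using B(1) cB by (intro card_seteq) auto
  then have inj: "inj_on ?c {..<?n}" using cB by (intro eq_card_imp_inj_on) auto
  have "(\<Sum>i<?n. coord x i *\<^sub>R ?c i) = 0"
  proof (rule poly_mapping_eqI)
    fix "is"
    show "Poly_Mapping.lookup (\<Sum>i<?n. coord x i *\<^sub>R ?c i) is = Poly_Mapping.lookup 0 is"
      using zero[of "is"] by (cases "is \<in> multi_indices (tl ns)")
        (simp_all add: lookup_sum lookup_scaleR lookup_unfolding_column mult.commute)
  qed
  \<comment> \<open>Independence speaks of coefficients indexed by vectors, so the coordinates are
    transported along the inverse of the injective column map.\<close>
  then have *: "(\<Sum>b\<in>?c ` {..<?n}. coord x (the_inv_into {..<?n} ?c b) *\<^sub>R b) = 0"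
    using inj by (simp add: sum.reindex the_inv_into_f_f)
  have "coord x i = 0" if i: "i < ?n" for i
    using independentD[OF B(2) _ _ *, of "?c i"] i Beq inj by (simp add: the_inv_into_f_f)
  then show ?thesis using x by (intro poly_mapping_eqI) (metis Rn_iff lookup_zero not_less)
qed

section \<open>The recursion\<close>

text \<open>The condition \<open>i + 2 < d\<close> expresses i \<le> d - 3 without truncated
  subtraction. The first three facts on \<open>P\<close> feed the diameter formula, the last one
  gives definiteness.\<close>

locale polytope_recursion =
  fixes p :: ereal and ns :: "nat list" and P :: "nat \<Rightarrow> rvec set" and A :: tensor and d :: nat
  assumes d: "3 \<le> d" "length ns = d" and p: "0 < p"
    and P: "\<And>i. 1 \<le> i \<Longrightarrow> i + 2 < d \<Longrightarrow> absorbing (ns ! i) (P i)"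
      "\<And>i. 1 \<le> i \<Longrightarrow> i + 2 < d \<Longrightarrow> convex (P i)"
      "\<And>i. 1 \<le> i \<Longrightarrow> i + 2 < d \<Longrightarrow> P i \<subseteq> Rn (ns ! i)"
    and polar_P: "\<And>i. 1 \<le> i \<Longrightarrow> i + 2 < d \<Longrightarrow> absorbing (ns ! i) (polar (ns ! i) (P i))"
begin

abbreviation in_spaces :: "rvec list \<Rightarrow> nat \<Rightarrow> bool" where
  "in_spaces xs j \<equiv> list_all2 (\<lambda>x n. x \<in> Rn n) xs (take j ns)"

lemma in_spaces_length: "in_spaces xs j \<Longrightarrow> j \<le> d \<Longrightarrow> length xs = j"
  using d by (auto dest: list_all2_lengthD)

lemma in_spaces_snoc: "in_spaces xs j \<Longrightarrow> j < d \<Longrightarrow> x \<in> Rn (ns ! j) \<Longrightarrow> in_spaces (xs @ [x]) (Suc j)"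
  using d by (simp add: take_Suc_conv_app_nth list_all2_appendI)

lemma in_spaces_update:
  "in_spaces xs j \<Longrightarrow> k < j \<Longrightarrow> j \<le> d \<Longrightarrow> x \<in> Rn (ns ! k) \<Longrightarrow> in_spaces (xs[k := x]) j"
  using d list_all2_update_cong[of "\<lambda>x n. x \<in> Rn n" xs "take j ns" x "take j ns ! k" k]
  by (simp only: list_update_id) simp

lemma Lam_final:
  "Lam p ns P A (d - 2) xs =
     vec_p p (ns ! (d - 2)) (ns ! (d - 1)) (\<lambda>k l. contract ns A xs [k, l])"
proof -
  have "length ns \<le> d - 2 + 2" using d by simp
  then show ?thesis using d by (subst Lam.simps) simp
qed

text \<open>The supremum runs over a set that does not involve \<open>xs\<close>. The semi-norm
  premise concerns the next level, so it has to come out of the same downward induction that uses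
  this identity.\<close>

lemma Lam_step:
  assumes j: "1 \<le> j" "j + 2 < d"
    and N: "seminorm_on (Rn (ns ! j)) (\<lambda>w. Lam p ns P A (Suc j) (xs @ [w]))"
  shows "Lam p ns P A j xs =
    (SUP w\<in>polar (ns ! j) (P j). 2 * Lam p ns P A (Suc j) (xs @ [w]))"
  using diam_polar_unit_ball[OF P[OF j] N] j d by (simp add: Lam.simps[of _ _ _ _ j])

text \<open>Downward induction from level d - 2, for all slots at once: the last slot of the next
  level justifies \<open>Lam_step\<close>, and slot \<open>k\<close> of the next level is inherited
  by the supremum.\<close>

lemma seminorm_on_Lam:
  assumes "1 \<le> j" "j \<le> d - 2" "k < j" "in_spaces xs j"
  shows "seminorm_on (Rn (ns ! k)) (\<lambda>x. Lam p ns P A j (xs[k := x]))"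
  using assms(2,1,3,4)
proof (induction j arbitrary: k xs rule: inc_induct)
  case base
  then have k: "k < length xs" using in_spaces_length[of xs "d - 2"] by simp
  show ?case
    unfolding Lam_final
    by (rule seminorm_on_vec_p[OF p subspace_Rn])
      (simp_all add: contract_update_add[OF k] contract_update_scale[OF k])
next
  case (step j)
  have j: "1 \<le> j" "j + 2 < d" "j < d" using step.hyps step.prems by auto
  \<comment> \<open>The appended 0 is a placeholder that the update in the last slot
    overwrites.\<close>
  have last: "seminorm_on (Rn (ns ! j)) (\<lambda>w. Lam p ns P A (Suc j) (ys @ [w]))"
    if ys: "in_spaces ys j" for ys
    using step.IH[of j "ys @ [0]"] in_spaces_snoc[OF ys, of 0] in_spaces_length[OF ys] j
    by (simp add: list_update_append)
  have len: "length xs = j" using in_spaces_length[OF step.prems(3)] j by simp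
  have upd: "in_spaces (xs[k := x]) j" if "x \<in> Rn (ns ! k)" for x
    using in_spaces_update[OF step.prems(3)] that step.prems j by simp
  let ?W = "polar (ns ! j) (P j)"
  have slot: "seminorm_on (Rn (ns ! k)) (\<lambda>x. 2 * Lam p ns P A (Suc j) (xs[k := x] @ [w]))"
    if w: "w \<in> ?W" for w
  proof -
    have "in_spaces (xs @ [w]) (Suc j)"
      using w step.prems j by (intro in_spaces_snoc) (auto simp: polar_def)
    then show ?thesis
      using step.IH[of k "xs @ [w]"] step.prems len
      by (intro seminorm_on_scale) (simp_all add: list_update_append1)
  qed
  have "seminorm_on (Rn (ns ! k)) (\<lambda>x. SUP w\<in>?W. 2 * Lam p ns P A (Suc j) (xs[k := x] @ [w]))"
  proof (rule seminorm_on_SUP[OF _ slot _ subspace_Rn])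
    show "?W \<noteq> {}" by (auto simp: polar_def dot_simps intro!: exI[of _ 0])
    \<comment> \<open>For fixed \<open>x\<close> these are values of a semi-norm in \<open>w\<close>
      on the polar of an absorbing set.\<close>
    show "bdd_above ((\<lambda>w. 2 * Lam p ns P A (Suc j) (xs[k := x] @ [w])) ` ?W)"
      if "x \<in> Rn (ns ! k)" for x
      using bdd_above_seminorm_polar[OF P(1)[OF j(1,2)] seminorm_on_scale[OF last[OF upd[OF that]], of 2]]
      by simp
  qed
  \<comment> \<open>\<open>Lam_step\<close> is available only for \<open>x\<close> in the space, so
    the equality is transferred through closure of the space under sums and multiples.\<close>
  then show ?case
    using Lam_step[OF j(1,2) last[OF upd]] by (simp add: seminorm_on_def subspace_add subspace_scale subspace_Rn)
qed

lemma seminorm_on_Lam_snoc: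
  assumes "j < d - 2" "in_spaces xs j"
  shows "seminorm_on (Rn (ns ! j)) (\<lambda>w. Lam p ns P A (Suc j) (xs @ [w]))"
  using seminorm_on_Lam[of "Suc j" j "xs @ [0]"] in_spaces_snoc[OF assms(2), of 0]
    in_spaces_length[OF assms(2)] assms(1) by (simp add: list_update_append)

text \<open>A vanishing supremum makes the next level vanish on the whole polar, hence by absorption
  and homogeneity at each unit vector, which fixes one more index. At the last level
  \<open>vec_p\<close> detects the remaining matrix entries.\<close>

lemma Lam_eq_0_imp_contract_eq_0:
  assumes "1 \<le> j" "j \<le> d - 2" "in_spaces xs j" "Lam p ns P A j xs = 0" "is \<in> multi_indices (drop j ns)"
  shows "contract ns A xs is = 0"
  using assms(2,1,3-)
proof (induction j arbitrary: xs "is" rule: inc_induct)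
  case base
  have "drop (d - 2) ns = [ns ! (d - 2), ns ! (d - 1)]"
    using d Cons_nth_drop_Suc[of "d - 2" ns] Cons_nth_drop_Suc[of "d - 1" ns]
    by (simp add: Suc_diff_Suc numeral_2_eq_2)
  then obtain k l where "is = [k, l]" "k < ns ! (d - 2)" "l < ns ! (d - 1)"
    using base by (auto simp: multi_indices_Cons multi_indices_Nil)
  then show ?case using base vec_p_eq_0_imp[OF p] unfolding Lam_final by blast
next
  case (step j)
  have j: "1 \<le> j" "j + 2 < d" "j < d" using step.hyps step.prems by auto
  have len: "length xs = j" using in_spaces_length[OF step.prems(2)] j by simp
  note N = seminorm_on_Lam_snoc[OF step.hyps(2) step.prems(2)]
  obtain i js where is_eq: "is = i # js" "i < ns ! j" "js \<in> multi_indices (drop (Suc j) ns)"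
    using step.prems(4) Cons_nth_drop_Suc[of j ns, symmetric] d j by (auto simp: multi_indices_Cons)
  have u: "unit i \<in> Rn (ns ! j)" using is_eq by simp
  obtain t where t: "t > 0" "t *\<^sub>R unit i \<in> polar (ns ! j) (P j)"
    using polar_P[OF j(1,2)] u unfolding absorbing_def by blast
  have "2 * Lam p ns P A (Suc j) (xs @ [t *\<^sub>R unit i]) \<le> Lam p ns P A j xs"
    unfolding Lam_step[OF j(1,2) N]
    using bdd_above_seminorm_polar[OF P(1)[OF j(1,2)] seminorm_on_scale[OF N, of 2]]
    by (intro cSUP_upper[OF t(2)]) simp
  moreover have "Lam p ns P A (Suc j) (xs @ [t *\<^sub>R unit i]) = t * Lam p ns P A (Suc j) (xs @ [unit i])"
    using seminorm_onD(3)[OF N u, of t] t by simp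
  ultimately have "t * Lam p ns P A (Suc j) (xs @ [unit i]) \<le> 0" using step.prems(3) by simp
  then have "Lam p ns P A (Suc j) (xs @ [unit i]) = 0"
    using seminorm_onD(1)[OF N u] t by (simp add: mult_le_0_iff)
  then have "contract ns A (xs @ [unit i]) js = 0"
    using step.IH[of "xs @ [unit i]" js] in_spaces_snoc[OF step.prems(2) j(3) u] is_eq(3) by simp
  then show ?case using contract_snoc_unit[of xs ns i A js] is_eq len j d by simp
qed

lemma norm_on_Lam_1:
  assumes rank: "unfolding_full_column_rank ns A"
  shows "norm_on (Rn (ns ! 0)) (\<lambda>x. Lam p ns P A 1 [x])"
  unfolding norm_on_def
proof (intro conjI ballI impI)
  obtain n ms where ns: "ns = n # ms" using d by (cases ns) auto
  show "seminorm_on (Rn (ns ! 0)) (\<lambda>x. Lam p ns P A 1 [x])"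
    using seminorm_on_Lam[of 1 0 "[0]"] d by (simp add: ns)
  fix x assume x: "x \<in> Rn (ns ! 0)" and zero: "Lam p ns P A 1 [x] = 0"
  show "x = 0"
  proof (rule unfolding_injective[OF rank x])
    fix "is" assume "is \<in> multi_indices (tl ns)"
    then have "contract ns A [x] is = 0"
      using Lam_eq_0_imp_contract_eq_0[of 1 "[x]" "is"] x zero d by (simp add: ns)
    then show "(\<Sum>i<ns ! 0. A (i # is) * coord x i) = 0" by (simp add: ns contract_single)
  qed
qed

end

text \<open>Both recursions unfold in parallel down to \<open>contract_contract\<close>. Dropping
  the first mode lowers each position by one, and the shift of \<open>P\<close> keeps the same
  polytope in the same space.\<close>

lemma Lam_contract:
  assumes "Suc j + 2 \<le> length (n # ns)"
  shows "Lam p ns (\<lambda>k. P (Suc k)) (contract (n # ns) A [x]) j xs = Lam p (n # ns) P A (Suc j) (x # xs)"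
proof -
  have "j \<le> length ns - 2" using assms by simp
  then show ?thesis
  proof (induction j arbitrary: xs rule: inc_induct)
    case base
    \<comment> \<open>With length m + 2 the final level is m for the contracted tensor and m + 1 for
      the full one.\<close>
    obtain m where "length ns = Suc (Suc m)" using assms le_Suc_ex[of 2 "length ns"] by auto
    then show ?case by (simp add: Lam.simps[of _ _ _ _ m] Lam.simps[of _ _ _ _ "Suc m"] contract_contract)
  next
    case (step j)
    then have "\<not> length ns \<le> j + 2" by simp
    then show ?case
      using step.IH by (simp add: Lam.simps[of _ ns _ _ j] Lam.simps[of _ "n # ns" _ _ "Suc j"])
  qed
qed

theorem proposition8:
  fixes d :: nat and p :: ereal and c C :: real
    and ns :: "nat list" and P :: "nat \<Rightarrow> rvec set" and A :: tensor
  assumes "3 \<le> d" and "2 < p"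
    and "length ns = d"
    and "0 < c" and "0 < C"
    and "\<forall>i\<in>{1..d-3}. approximating_polytope c C p (ns ! i) (P i)"
    and "\<exists>is\<in>multi_indices ns. A is \<noteq> 0"
  shows "(\<forall>j\<in>{1..d-2}. \<forall>k\<in>{1..j}. \<forall>xs.
            list_all2 (\<lambda>x n. x \<in> Rn n) xs (take j ns) \<longrightarrow>
            seminorm_on (Rn (ns ! (k - 1))) (\<lambda>x. Lam p ns P A j (xs[k - 1 := x])))
       \<and> (unfolding_full_column_rank ns A \<longrightarrow>
            norm_on (Rn (ns ! 0)) (\<lambda>x. Lam p ns P A 1 [x]))
       \<and> (\<forall>i\<in>{2..d-2}. \<forall>x xs.
            list_all2 (\<lambda>x n. x \<in> Rn n) (x # xs) (take i ns) \<longrightarrow>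
            Lam p (tl ns) (\<lambda>k. P (Suc k)) (contract ns A [x]) (i - 1) xs
              = Lam p ns P A i (x # xs))"
proof -
  obtain q where q: "conjugate_exponent p = ereal q" "0 < q"
    using conjugate_exponent_real[OF assms(2)] by blast
  have P: "polytope (P i)" "P i \<subseteq> Rn (ns ! i)" "lp_ball (ereal q) (ns ! i) 1 \<subseteq> P i"
    if "1 \<le> i" "i + 2 < d" for i
    using assms(6) that unfolding approximating_polytope_def Let_def q(1) by auto
  interpret polytope_recursion p ns P A d
  proof
    show "0 < p" using assms(2) by (rule order_less_trans[rotated]) simp
    fix i assume i: "1 \<le> i" "i + 2 < d"
    show "convex (P i)" using P(1)[OF i] by (auto simp: polytope_def)
    show "P i \<subseteq> Rn (ns ! i)" by (rule P(2)[OF i])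
    show "absorbing (ns ! i) (P i)" by (rule absorbing_if_unit_ball_subset[OF q(2) P(3)[OF i]])
    show "absorbing (ns ! i) (polar (ns ! i) (P i))" by (rule absorbing_polar_polytope[OF P(1)[OF i]])
  qed (fact assms(1,3))+
  obtain n ms where ns: "ns = n # ms" using assms(1,3) by (cases ns) auto
  show ?thesis
  proof (intro conjI ballI allI impI)
    fix j k xs assume "j \<in> {1..d-2}" "k \<in> {1..j}" "in_spaces xs j"
    then show "seminorm_on (Rn (ns ! (k - 1))) (\<lambda>x. Lam p ns P A j (xs[k - 1 := x]))"
      \<comment> \<open>Slots are counted from 1 in the claim and from 0 in the lemma; k \<ge> 1
        makes the subtraction exact.\<close>
      by (intro seminorm_on_Lam) auto
  next
    assume "unfolding_full_column_rank ns A"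
    then show "norm_on (Rn (ns ! 0)) (\<lambda>x. Lam p ns P A 1 [x])" by (rule norm_on_Lam_1)
  next
    fix i x xs assume i: "i \<in> {2..d-2}"
    \<comment> \<open>The level \<open>i - 1\<close> is not truncated because i \<ge> 2.\<close>
    have "Suc i \<le> length ms" "Suc (i - 1) = i" using i assms(3) by (auto simp: ns)
    then show "Lam p (tl ns) (\<lambda>k. P (Suc k)) (contract ns A [x]) (i - 1) xs = Lam p ns P A i (x # xs)"
      using Lam_contract[of "i - 1" n ms p P A x xs] by (simp add: ns)
  qed
qed

end
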